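(* Let $n\ge k\ge 0$ be integers and $a,b,c$ real numbers. At all real $(x,y)$ with $x\ne 1$ the following hold: $$(2n+a+b+c+2)P_{n,k}^{(a,b,c)}=(n+k+a+b+c+2)P_{n,k}^{(a+1,b,c)}+(n+k+b+c+1)P_{n-1,k}^{(a+1,b,c)},$$ $$\begin{aligned} (2n+a+b+c+2)(2k+b+c+1)P_{n,k}^{(a,b,c)}&=(n+k+a+b+c+2)(k+b+c+1)P_{n,k}^{(a,b+1,c)}\\ &\quad-(n-k+a)(k+b+c+1)P_{n-1,k}^{(a,b+1,c)}\\ &\quad+(k+c)(n+k+b+c+1)P_{n-1,k-1}^{(a,b+1,c)}\\ &\quad-(k+c)(n-k+1)P_{n,k-1}^{(a,b+1,c)}, \end{aligned}$$ $$\begin{aligned} (2n+a+b+c+2)(2k+b+c+1)P_{n,k}^{(a,b,c)}&=(n+k+a+b+c+2)(k+b+c+1)P_{n,k}^{(a,b,c+1)}\\ &\quad-(n-k+a)(k+b+c+1)P_{n-1,k}^{(a,b,c+1)}\\ &\quad-(k+b)(n+k+b+c+1)P_{n-1,k-1}^{(a,b,c+1)}\\ &\quad+(k+b)(n-k+1)P_{n,k-1}^{(a,b,c+1)}. \end{aligned}$$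
   Context: Jacobi polynomials: for an integer $m\ge 0$ and real $\alpha,\beta$, $P_m^{(\alpha,\beta)}(x)=\sum_{s=0}^m\binom{m+\alpha}{m-s}\binom{m+\beta}{s}\left(\frac{x-1}{2}\right)^s\left(\frac{x+1}{2}\right)^{m-s}$ (generalized binomial coefficients), and $P_{-1}^{(\alpha,\beta)}=0$. Shifted Jacobi polynomials: $\tilde P_m^{(\alpha,\beta)}(x)=P_m^{(\alpha,\beta)}(2x-1)$. For real $a,b,c$ and integers $n,k$, at points with $x\ne1$, $$P_{n,k}^{(a,b,c)}(x,y)=\tilde P_{n-k}^{(2k+b+c+1,a)}(x)\,(1-x)^k\,\tilde P_k^{(c,b)}\!\left(\tfrac{y}{1-x}\right)\qquad (n\ge k\ge 0),$$ and $P_{n,k}^{(a,b,c)}=0$ whenever $k=-1$ or $n-k=-1$. *)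

theory Defs
  imports Complex_Main
begin

text \<open>
  Indices are integers, because the contiguous relations refer to index -1, where the
  polynomials are zero by convention. The value 0 at indices below -1 is arbitrary.
\<close>

definition jacobi :: "int \<Rightarrow> real \<Rightarrow> real \<Rightarrow> real \<Rightarrow> real" where
  "jacobi m \<alpha> \<beta> x =
     (if m < 0 then 0
      else (\<Sum>s=0..nat m. ((of_int m + \<alpha>) gchoose (nat m - s)) * ((of_int m + \<beta>) gchoose s)
              * ((x - 1) / 2) ^ s * ((x + 1) / 2) ^ (nat m - s)))"

definition shifted_jacobi :: "int \<Rightarrow> real \<Rightarrow> real \<Rightarrow> real \<Rightarrow> real" where
  "shifted_jacobi m \<alpha> \<beta> x = jacobi m \<alpha> \<beta> (2 * x - 1)"

text \<open>
  Bivariate Jacobi polynomials on the triangle, evaluated by their product formula. This is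
  meant for \<open>x \<noteq> 1\<close> only: at \<open>x = 1\<close> the quotient is 0 by totality of division, which need not
  give the value of the polynomial there.
\<close>

definition triangle_jacobi ::
  "int \<Rightarrow> int \<Rightarrow> real \<Rightarrow> real \<Rightarrow> real \<Rightarrow> real \<Rightarrow> real \<Rightarrow> real" where
  "triangle_jacobi n k a b c x y =
     (if k < 0 \<or> n - k < 0 then 0
      else shifted_jacobi (n - k) (2 * of_int k + b + c + 1) a x
             * (1 - x) ^ nat k * shifted_jacobi k c b (y / (1 - x)))"

end

theory Submission
  imports Defs
begin

text \<open>
  Put \<open>u = (t - 1) / 2\<close> and \<open>v = (t + 1) / 2\<close>. The Jacobi polynomial of degree \<open>m\<close> is the value
  at \<open>a = m + \<alpha>\<close>, \<open>b = m + \<beta>\<close> of the form \<open>\<Sum>s\<le>m. (a gchoose (m - s)) (b gchoose s) u\<^sup>s v\<^bsup>m-s\<^esup>\<close>.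
  Pascal's rule in \<open>b\<close> and one coefficientwise recurrence in the degree, made homogeneous by means
  of \<open>v - u = 1\<close>, give the two one-variable contiguous relations used here: raising \<open>\<beta>\<close>, and
  multiplication by \<open>(1 - t) / 2\<close> with lowering of \<open>\<alpha>\<close>. Exchanging \<open>u\<close> and \<open>v\<close> gives the relation
  raising \<open>\<alpha>\<close>. The relations on the triangle follow by applying these to the two factors.
\<close>

definition jacobi_form :: "nat \<Rightarrow> real \<Rightarrow> real \<Rightarrow> real \<Rightarrow> real \<Rightarrow> real" where
  "jacobi_form n a b u v =
     (\<Sum>s\<le>n. (a gchoose (n - s)) * (b gchoose s) * u ^ s * v ^ (n - s))"

lemma jacobi_form_0 [simp]: "jacobi_form 0 a b u v = 1"
  by (simp add: jacobi_form_def)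

lemma jacobi_form_swap: "jacobi_form n a b u v = jacobi_form n b a v u"
  unfolding jacobi_form_def
  by (rule sum.reindex_bij_witness [of _ "\<lambda>s. n - s" "\<lambda>s. n - s"]) (simp_all add: mult_ac)

text \<open>The coefficients are padded with zero at \<open>s = 0\<close> (and in the companion
  lemma at \<open>s = Suc n\<close>), so that both products become sums over the same range
  \<open>s \<le> Suc n\<close> and can be compared term by term.\<close>

lemma mult_form_left:
  fixes u v :: real
  shows "u * (\<Sum>s\<le>n. f s * u ^ s * v ^ (n - s)) =
    (\<Sum>s\<le>Suc n. (if s = 0 then 0 else f (s - 1)) * u ^ s * v ^ (Suc n - s))"
  by (subst sum.atMost_Suc_shift) (simp add: sum_distrib_left mult_ac)

lemma mult_form_right:
  fixes u v :: real
  shows "v * (\<Sum>s\<le>n. f s * u ^ s * v ^ (n - s)) =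
    (\<Sum>s\<le>Suc n. (if s \<le> n then f s else 0) * u ^ s * v ^ (Suc n - s))"
  by (simp add: sum_distrib_left Suc_diff_le mult_ac)

text \<open>Absorption, stated with the same zero default at \<open>s = 0\<close> as the padding
  above, so that it applies uniformly to all coefficients.\<close>

lemma gbinomial_pred:
  fixes b :: real
  shows "real s * (b gchoose s) = (b + 1 - real s) * (if s = 0 then 0 else b gchoose (s - 1))"
proof (cases s)
  case (Suc t)
  then show ?thesis
    using gbinomial_absorption[of t b] gbinomial_absorb_comp[of b t] by (simp add: algebra_simps)
qed simp

lemma jacobi_form_pascal:
  "jacobi_form (Suc n) a (b + 1) u v = jacobi_form (Suc n) a b u v + u * jacobi_form n a b u v"
proof -
  have "(a gchoose (Suc n - s)) * ((b + 1) gchoose s) =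
      (a gchoose (Suc n - s)) * (b gchoose s) +
      (if s = 0 then 0 else (a gchoose (n - (s - 1))) * (b gchoose (s - 1)))" for s
    by (cases s) (simp_all add: gbinomial_Suc_Suc distrib_left)
  then show ?thesis
    unfolding jacobi_form_def mult_form_left
    by (simp add: sum.distrib [symmetric] ring_distribs del: sum.atMost_Suc)
qed

text \<open>Split the factor \<open>Suc n\<close> on the term u^s v^r as \<open>r + s\<close>, where
  \<open>r = Suc n - s\<close>. Absorption in \<open>a\<close> turns the \<open>r\<close> part into
  lower binomials of \<open>a - 1\<close>, and absorption in \<open>b\<close> lowers
  \<open>s\<close>. Both sides are homogeneous of degree \<open>Suc n\<close>, so \<open>u\<close>
  and \<open>v\<close> remain independent here.\<close>

lemma jacobi_form_Suc:
  "real (Suc n) * jacobi_form (Suc n) a b u v =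
     a * (v - u) * jacobi_form n (a - 1) b u v + (a + b - real n) * u * jacobi_form n a b u v"
proof -
  \<comment> \<open>\<open>F\<close>, \<open>G\<close> and \<open>H\<close> are the padded
    coefficients of \<open>v\<close> times the form at \<open>a - 1\<close>, \<open>u\<close> times
    the form at \<open>a - 1\<close>, and \<open>u\<close> times the form at
    \<open>a\<close>.\<close>
  define F where "F = (\<lambda>s. if s \<le> n then ((a - 1) gchoose (n - s)) * (b gchoose s) else 0)"
  define G where
    "G = (\<lambda>s. if s = 0 then 0 else ((a - 1) gchoose (n - (s - 1))) * (b gchoose (s - 1)))"
  define H where "H = (\<lambda>s. if s = 0 then 0 else (a gchoose (n - (s - 1))) * (b gchoose (s - 1)))"
  have coeff: "real (Suc n) * ((a gchoose (Suc n - s)) * (b gchoose s)) =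
      a * F s - a * G s + (a + b - real n) * H s" if "s \<le> Suc n" for s
  proof -
    define r where "r = Suc n - s"
    define A where "A = (a gchoose r)"
    define B' where "B' = (if s = 0 then 0 else b gchoose (s - 1))"
    have r: "real r = real n + 1 - real s"
      using that by (simp add: r_def of_nat_diff)
    have "a * (if s \<le> n then ((a - 1) gchoose (n - s)) else 0) = real r * A"
      using gbinomial_absorption[of "n - s" a] that
      by (cases "s \<le> n") (simp_all add: r_def A_def Suc_diff_le)
    then have F: "a * F s = real r * A * (b gchoose s)"
      by (auto simp: F_def)
    have idx: "n - (s - 1) = r" if "s \<noteq> 0"
      using that by (simp add: r_def)
    have "G s = ((a - 1) gchoose r) * B'"
      by (cases "s = 0") (simp_all only: G_def B'_def idx simp_thms if_True if_False mult_zero_right)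
    then have G: "a * G s = (a - real r) * A * B'"
      using gbinomial_absorb_comp [of a r] by (simp add: A_def)
    have H: "H s = A * B'"
      by (cases "s = 0") (simp_all only: H_def B'_def A_def idx simp_thms if_True if_False
          mult_zero_right)
    \<comment> \<open>The factors of \<open>A * B'\<close> coming from \<open>G\<close> and
      \<open>H\<close> add up to \<open>- (a - r) + (a + b - n) = b + 1 - s\<close>, exactly the
      factor that absorption produces.\<close>
    have "real s * (b gchoose s) = (b + 1 - real s) * B'"
      unfolding B'_def by (rule gbinomial_pred)
    then have "A * (real s * (b gchoose s)) = A * ((b + 1 - real s) * B')"
      by simp
    then show ?thesis
      unfolding F G H r_def [symmetric] A_def [symmetric] r by (simp add: algebra_simps)
  qed
  have "real (Suc n) * jacobi_form (Suc n) a b u v =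
      (\<Sum>s\<le>Suc n. (real (Suc n) * ((a gchoose (Suc n - s)) * (b gchoose s))) * u ^ s * v ^ (Suc n - s))"
    by (simp add: jacobi_form_def sum_distrib_left mult_ac del: sum.atMost_Suc of_nat_Suc)
  also have "\<dots> = (\<Sum>s\<le>Suc n. (a * F s - a * G s + (a + b - real n) * H s)
      * u ^ s * v ^ (Suc n - s))"
    by (rule sum.cong) (simp_all only: coeff atMost_iff)
  also have "\<dots> = a * (\<Sum>s\<le>Suc n. F s * u ^ s * v ^ (Suc n - s))
      - a * (\<Sum>s\<le>Suc n. G s * u ^ s * v ^ (Suc n - s))
      + (a + b - real n) * (\<Sum>s\<le>Suc n. H s * u ^ s * v ^ (Suc n - s))"
    by (simp only: sum_distrib_left sum.distrib sum_subtractf ring_distribs mult.assoc)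
  also have "\<dots> = a * (v * jacobi_form n (a - 1) b u v) - a * (u * jacobi_form n (a - 1) b u v)
      + (a + b - real n) * (u * jacobi_form n a b u v)"
    unfolding F_def G_def H_def jacobi_form_def mult_form_left mult_form_right ..
  finally show ?thesis
    by (simp add: algebra_simps)
qed

lemma jacobi_eq_form:
  assumes "0 \<le> m"
  shows "jacobi m \<alpha> \<beta> t =
    jacobi_form (nat m) (of_int m + \<alpha>) (of_int m + \<beta>) ((t - 1) / 2) ((t + 1) / 2)"
  using assms by (simp add: jacobi_def jacobi_form_def atLeast0AtMost)

lemma jacobi_neg [simp]: "m < 0 \<Longrightarrow> jacobi m \<alpha> \<beta> t = 0"
  by (simp add: jacobi_def)

text \<open>The map t to -t sends \<open>(u, v)\<close> to \<open>(- v, - u)\<close>. Homogeneity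
  gives the sign, and the swap symmetry exchanges the parameters.\<close>

lemma jacobi_form_reflect:
  "jacobi_form n a b ((- t - 1) / 2) ((- t + 1) / 2) =
     (-1) ^ n * jacobi_form n b a ((t - 1) / 2) ((t + 1) / 2)"
proof -
  have neg: "jacobi_form n a b (- u) (- v) = (-1) ^ n * jacobi_form n a b u v" for u v
    unfolding jacobi_form_def sum_distrib_left
    by (rule sum.cong)
      (simp_all add: power_minus [of u] power_minus [of v] mult_ac flip: power_add)
  have "(- t - 1) / 2 = - ((t + 1) / 2)" "(- t + 1) / 2 = - ((t - 1) / 2)"
    by (simp_all add: field_simps)
  then show ?thesis
    by (simp only: neg) (simp only: jacobi_form_swap [of n a b])
qed

lemma jacobi_raise_beta:
  assumes "0 \<le> m"
  shows "(2 * of_int m + \<alpha> + \<beta> + 1) * jacobi m \<alpha> \<beta> t =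
    (of_int m + \<alpha> + \<beta> + 1) * jacobi m \<alpha> (\<beta> + 1) t
      + (of_int m + \<alpha>) * jacobi (m - 1) \<alpha> (\<beta> + 1) t"
proof (cases "nat m")
  case 0
  with assms have "m = 0" by simp
  then show ?thesis by (simp add: jacobi_eq_form)
next
  case (Suc n)
  then have m: "m = int n + 1" by simp
  define a where "a = real n + 1 + \<alpha>"
  define b where "b = real n + 1 + \<beta>"
  define u where "u = (t - 1) / 2"
  define v where "v = (t + 1) / 2"
  have uv: "v - u = 1" by (simp add: u_def v_def field_simps)
  have J: "jacobi m \<alpha> \<beta> t = jacobi_form (Suc n) a b u v"
    "jacobi m \<alpha> (\<beta> + 1) t = jacobi_form (Suc n) a (b + 1) u v"
    "jacobi (m - 1) \<alpha> (\<beta> + 1) t = jacobi_form n (a - 1) b u v"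
    by (simp_all add: jacobi_eq_form m a_def b_def u_def v_def nat_add_distrib algebra_simps)
  \<comment> \<open>Pascal's rule eliminates \<open>u * jacobi_form n a b u v\<close> from the
    degree recurrence.\<close>
  have "(a + b + 1) * jacobi_form (Suc n) a b u v =
      (a + b - real n) * jacobi_form (Suc n) a (b + 1) u v + a * jacobi_form n (a - 1) b u v"
    using jacobi_form_Suc [of n a b u v] jacobi_form_pascal [of n a b u v] uv
    unfolding of_nat_Suc by algebra
  then show ?thesis
    unfolding J by (simp add: m a_def b_def algebra_simps)
qed

lemma jacobi_minus: "jacobi m \<alpha> \<beta> (- t) = (-1) ^ nat m * jacobi m \<beta> \<alpha> t"
  by (cases "m < 0") (simp_all only: jacobi_neg mult_zero_right jacobi_eq_form not_less jacobi_form_reflect)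

lemma jacobi_raise_alpha:
  assumes "0 \<le> m"
  shows "(2 * of_int m + \<alpha> + \<beta> + 1) * jacobi m \<alpha> \<beta> t =
    (of_int m + \<alpha> + \<beta> + 1) * jacobi m (\<alpha> + 1) \<beta> t
      - (of_int m + \<beta>) * jacobi (m - 1) (\<alpha> + 1) \<beta> t"
proof (cases "m = 0")
  case True
  then show ?thesis by (simp add: jacobi_eq_form)
next
  case False
  have J: "jacobi l \<gamma> \<delta> t = (-1) ^ nat l * jacobi l \<delta> \<gamma> (- t)" for l \<gamma> \<delta>
    by (simp add: jacobi_minus flip: power_mult_distrib mult.assoc)
  \<comment> \<open>Consecutive degrees carry opposite reflection signs, whence the minus in the
    result. This fails at \<open>m = 0\<close>, where \<open>nat\<close> sends both 0 and -1 to
    0.\<close>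
  have "nat m = Suc (nat (m - 1))"
    using assms False by simp
  then have "(-1) ^ nat m = - ((-1 :: real) ^ nat (m - 1))"
    by simp
  then show ?thesis
    using arg_cong [OF jacobi_raise_beta [OF assms, of \<beta> \<alpha> "- t"],
        of "\<lambda>z. (-1) ^ nat m * z"]
    by (simp add: J [of m] J [of "m - 1"] algebra_simps)
qed

lemma jacobi_lower_alpha:
  assumes "0 \<le> m"
  shows "(2 * of_int m + \<alpha> + \<beta> + 1) * ((1 - t) / 2) * jacobi m \<alpha> \<beta> t =
    (of_int m + \<alpha>) * jacobi m (\<alpha> - 1) \<beta> t
      - (of_int m + 1) * jacobi (m + 1) (\<alpha> - 1) \<beta> t"
proof -
  define n where "n = nat m"
  then have m: "m = int n" using assms by simp
  define a where "a = real n + \<alpha>"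
  define b where "b = real n + \<beta>"
  define u where "u = (t - 1) / 2"
  define v where "v = (t + 1) / 2"
  have uv: "v - u = 1" by (simp add: u_def v_def field_simps)
  have J: "jacobi m \<alpha> \<beta> t = jacobi_form n a b u v"
    "jacobi m (\<alpha> - 1) \<beta> t = jacobi_form n (a - 1) b u v"
    "jacobi (m + 1) (\<alpha> - 1) \<beta> t = jacobi_form (Suc n) a (b + 1) u v"
    by (simp_all add: jacobi_eq_form m a_def b_def u_def v_def nat_add_distrib algebra_simps)
  have t: "(1 - t) / 2 = - u" by (simp add: u_def field_simps)
  \<comment> \<open>This time Pascal's rule eliminates \<open>jacobi_form (Suc n) a b u v\<close>,
    and the term with factor \<open>u\<close> is kept.\<close>
  have "(a + b + 1) * (- u) * jacobi_form n a b u v =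
      a * jacobi_form n (a - 1) b u v - (real n + 1) * jacobi_form (Suc n) a (b + 1) u v"
    using jacobi_form_Suc [of n a b u v] jacobi_form_pascal [of n a b u v] uv
    unfolding of_nat_Suc by algebra
  then show ?thesis
    unfolding J t by (simp add: m a_def b_def algebra_simps)
qed

text \<open>One factor \<open>1 - x\<close> of the power is absorbed into the first polynomial,
  lowering its parameter to \<open>2 * k + b + c\<close>. This is the parameter belonging to index
  \<open>k - 1\<close> once \<open>b\<close> or \<open>c\<close> is raised by one; \<open>b'\<close>
  and \<open>c'\<close> stay free to serve both cases.\<close>

lemma triangle_jacobi_lower:
  assumes "0 \<le> k" "k \<le> n" "x \<noteq> 1"
  shows "(2 * of_int n + a + b + c + 2)
      * (shifted_jacobi (n - k) (2 * of_int k + b + c + 1) a x * (1 - x) ^ nat k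
        * shifted_jacobi (k - 1) c' b' (y / (1 - x))) =
    (of_int n + of_int k + b + c + 1)
      * (shifted_jacobi (n - k) (2 * of_int k + b + c) a x * (1 - x) ^ nat (k - 1)
        * shifted_jacobi (k - 1) c' b' (y / (1 - x)))
    - (of_int n - of_int k + 1)
      * (shifted_jacobi (n - k + 1) (2 * of_int k + b + c) a x * (1 - x) ^ nat (k - 1)
        * shifted_jacobi (k - 1) c' b' (y / (1 - x)))"
\<comment> \<open>At \<open>k = 0\<close> the power cannot be split, but every term contains the
  polynomial of degree -1 and vanishes.\<close>
proof (cases "k = 0")
  case False
  then have "nat k = Suc (nat (k - 1))"
    using assms by simp
  then have pow: "(1 - x) ^ nat k = (1 - x) * (1 - x) ^ nat (k - 1)"
    by simp
  have half: "(1 - (2 * x - 1)) / 2 = 1 - x"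
    by (simp add: field_simps)
  have "(2 * of_int n + a + b + c + 2) * (1 - x)
        * shifted_jacobi (n - k) (2 * of_int k + b + c + 1) a x =
      (of_int n + of_int k + b + c + 1) * shifted_jacobi (n - k) (2 * of_int k + b + c) a x
      - (of_int n - of_int k + 1) * shifted_jacobi (n - k + 1) (2 * of_int k + b + c) a x"
    using jacobi_lower_alpha [of "n - k" "2 * of_int k + b + c + 1" a "2 * x - 1"] assms
    unfolding shifted_jacobi_def half by (simp add: algebra_simps)
  from arg_cong [OF this, of "\<lambda>z. z * ((1 - x) ^ nat (k - 1)
      * shifted_jacobi (k - 1) c' b' (y / (1 - x)))"]
  show ?thesis
    unfolding pow by (simp only: ring_distribs mult_ac)
qed (simp add: shifted_jacobi_def)

theorem corollary3:
  fixes n k :: int and a b c x y :: real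
  assumes "0 \<le> k" and "k \<le> n" and "x \<noteq> 1"
  shows
    "((2 * of_int n + a + b + c + 2) * triangle_jacobi n k a b c x y
       = (of_int n + of_int k + a + b + c + 2) * triangle_jacobi n k (a + 1) b c x y
         + (of_int n + of_int k + b + c + 1) * triangle_jacobi (n - 1) k (a + 1) b c x y)
     \<and> ((2 * of_int n + a + b + c + 2) * (2 * of_int k + b + c + 1) * triangle_jacobi n k a b c x y
       = (of_int n + of_int k + a + b + c + 2) * (of_int k + b + c + 1)
             * triangle_jacobi n k a (b + 1) c x y
         - (of_int n - of_int k + a) * (of_int k + b + c + 1)
             * triangle_jacobi (n - 1) k a (b + 1) c x y
         + (of_int k + c) * (of_int n + of_int k + b + c + 1)
             * triangle_jacobi (n - 1) (k - 1) a (b + 1) c x y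
         - (of_int k + c) * (of_int n - of_int k + 1)
             * triangle_jacobi n (k - 1) a (b + 1) c x y)
     \<and> ((2 * of_int n + a + b + c + 2) * (2 * of_int k + b + c + 1) * triangle_jacobi n k a b c x y
       = (of_int n + of_int k + a + b + c + 2) * (of_int k + b + c + 1)
             * triangle_jacobi n k a b (c + 1) x y
         - (of_int n - of_int k + a) * (of_int k + b + c + 1)
             * triangle_jacobi (n - 1) k a b (c + 1) x y
         - (of_int k + b) * (of_int n + of_int k + b + c + 1)
             * triangle_jacobi (n - 1) (k - 1) a b (c + 1) x y
         + (of_int k + b) * (of_int n - of_int k + 1)
             * triangle_jacobi n (k - 1) a b (c + 1) x y)"
proof -
  define X where "X = (\<lambda>m \<alpha> \<beta>. shifted_jacobi m \<alpha> \<beta> x)"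
  define Y where "Y = (\<lambda>m \<alpha> \<beta>. shifted_jacobi m \<alpha> \<beta> (y / (1 - x)))"
  define p where "p = 2 * of_int k + b + c + 1"
  \<comment> \<open>The case distinction in the definition disappears because each factor is already
    zero at negative degree.\<close>
  have T: "triangle_jacobi n' k' a' b' c' x y =
      X (n' - k') (2 * of_int k' + b' + c' + 1) a' * (1 - x) ^ nat k' * Y k' c' b'"
    for n' k' a' b' c'
    by (simp add: triangle_jacobi_def X_def Y_def shifted_jacobi_def)
  have nk: "0 \<le> n - k" using assms by simp
  have idx: "n - 1 - k = n - k - 1" "n - 1 - (k - 1) = n - k" "n - (k - 1) = n - k + 1"
    by simp_all
  have par: "2 * of_int k + (b + 1) + c + 1 = p + 1" "2 * of_int k + b + (c + 1) + 1 = p + 1"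
    "2 * of_int (k - 1) + (b + 1) + c + 1 = p - 1" "2 * of_int (k - 1) + b + (c + 1) + 1 = p - 1"
    "2 * of_int k + b + c + 1 = p"
    by (simp_all add: p_def)
  have Xa: "(2 * of_int n + a + b + c + 2) * X (n - k) p a =
      (of_int n + of_int k + a + b + c + 2) * X (n - k) p (a + 1)
      + (of_int n + of_int k + b + c + 1) * X (n - k - 1) p (a + 1)"
    using jacobi_raise_beta [OF nk, of p a "2 * x - 1"]
    by (simp add: X_def shifted_jacobi_def p_def algebra_simps)
  have Xp: "(2 * of_int n + a + b + c + 2) * X (n - k) p a =
      (of_int n + of_int k + a + b + c + 2) * X (n - k) (p + 1) a
      - (of_int n - of_int k + a) * X (n - k - 1) (p + 1) a"
    using jacobi_raise_alpha [OF nk, of p a "2 * x - 1"]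
    by (simp add: X_def shifted_jacobi_def p_def algebra_simps)
  have low: "(2 * of_int n + a + b + c + 2) * (X (n - k) p a * (1 - x) ^ nat k * Y (k - 1) c' b') =
      (of_int n + of_int k + b + c + 1) * (X (n - k) (p - 1) a * (1 - x) ^ nat (k - 1) * Y (k - 1) c' b')
      - (of_int n - of_int k + 1)
        * (X (n - k + 1) (p - 1) a * (1 - x) ^ nat (k - 1) * Y (k - 1) c' b')" for b' c'
    using triangle_jacobi_lower [OF assms, of a b c c' b' y] by (simp add: X_def Y_def p_def)
  have Yb: "(2 * of_int k + b + c + 1) * Y k c b =
      (of_int k + b + c + 1) * Y k c (b + 1) + (of_int k + c) * Y (k - 1) c (b + 1)"
    using jacobi_raise_beta [OF assms(1), of c b]
    by (simp add: Y_def shifted_jacobi_def algebra_simps)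
  have Yc: "(2 * of_int k + b + c + 1) * Y k c b =
      (of_int k + b + c + 1) * Y k (c + 1) b - (of_int k + b) * Y (k - 1) (c + 1) b"
    using jacobi_raise_alpha [OF assms(1), of c b]
    by (simp add: Y_def shifted_jacobi_def algebra_simps)
  \<comment> \<open>Naming the powers leaves polynomial identities in opaque real
    quantities.\<close>
  define q q' where "q = (1 - x) ^ nat k" and "q' = (1 - x) ^ nat (k - 1)"
  note low = low [folded q_def q'_def]
  show ?thesis
    unfolding T idx par q_def [symmetric] q'_def [symmetric]
  proof (intro conjI, goal_cases)
    case 1
    show ?case using Xa by algebra
  next
    case 2
    \<comment> \<open>\<open>Yb\<close> splits the second factor into degrees \<open>k\<close> and
      \<open>k - 1\<close>. The first part needs parameter \<open>p + 1\<close>, supplied by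
      \<open>Xp\<close>; the second needs \<open>p - 1\<close>, supplied by
      \<open>low\<close>.\<close>
    show ?case using Xp Yb low [of c "b + 1"] unfolding p_def [symmetric] by algebra
  next
    case 3
    show ?case using Xp Yc low [of "c + 1" b] unfolding p_def [symmetric] by algebra
  qed
qed

end
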